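(* Let $f,g\in\mathcal H_{(d)}$ be nonzero and $x,y\in\mathbb C^{n+1}$ be nonzero, with $\operatorname{rank}Df(x)|_{x^\perp}=n$, $u\le 1/20$ and $v\le 1/20$. Then $\operatorname{rank}Dg(y)|_{y^\perp}=n$ and \[(1-3.805u-v)\,\mu(g,y)\le\mu(f,x)\le(1+3.504u+v)\,\mu(g,y).\]
   Context: $n\ge2$, $(d)=(d_1,\dots,d_n)$, $D=\max_i d_i\ge2$. $\mathcal H_{(d)}$: systems of $n$ homogeneous polynomials in $n+1$ complex variables of degrees $d_i$, with the Bombieri–Weyl inner product $\langle f,g\rangle=\sum_i\sum_{|\alpha|=d_i}\frac{\alpha_0!\cdots\alpha_n!}{d_i!}f_{i,\alpha}\overline{g_{i,\alpha}}$ and its norm. $x^\perp$ is the Hermitian orthogonal complement of $x$; $Df(x)|_{x^\perp}$ the restriction of the derivative. $\mu(f,x)=\|f\|\,\|(Df(x)|_{x^\perp})^{-1}\mathrm{diag}(\sqrt{d_i}\|x\|^{d_i-1})\|$ (operator norm), $\infty$ if not invertible. $d_R(x,y)\in[0,\pi/2]$ with $\cos d_R(x,y)=|\langle x,y\rangle|/(\|x\|\|y\|)$. $u=\frac{D^{3/2}}{2}\mu(f,x)d_R(x,y)$, $v=D^{1/2}\mu(f,x)\,\big\|\frac{f}{\|f\|}-\frac{g}{\|g\|}\big\|$. *)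

theory Defs
  imports "HOL-Analysis.Analysis"
begin

text \<open>Vectors of C^(n+1) are elements of complex^'m, with CARD('m) = n+1;
  C^n is complex^'n (index set of the equations).  A system f in H_(d) is
  given by its coefficients: f i \<alpha> is the coefficient of the monomial
  X^\<alpha> in the i-th polynomial, where \<alpha> ranges over multi-indices
  \<alpha> :: 'm \<Rightarrow> nat of total degree d i (values outside are ignored).\<close>

definition multi_idx :: "nat \<Rightarrow> ('m::finite \<Rightarrow> nat) set" where
  "multi_idx k = {\<alpha>. (\<Sum>j\<in>UNIV. \<alpha> j) = k}"

type_synonym ('n, 'm) system = "'n \<Rightarrow> ('m \<Rightarrow> nat) \<Rightarrow> complex"

definition sys_nonzero :: "('n::finite \<Rightarrow> nat) \<Rightarrow> ('n, 'm::finite) system \<Rightarrow> bool" where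
  "sys_nonzero d f \<longleftrightarrow> (\<exists>i. \<exists>\<alpha>\<in>multi_idx (d i). f i \<alpha> \<noteq> 0)"

definition bw_norm :: "('n::finite \<Rightarrow> nat) \<Rightarrow> ('n, 'm::finite) system \<Rightarrow> real" where
  "bw_norm d f = sqrt (\<Sum>i\<in>UNIV. \<Sum>\<alpha>\<in>multi_idx (d i).
      (real (\<Prod>j\<in>UNIV. fact (\<alpha> j)) / real (fact (d i))) * (cmod (f i \<alpha>))\<^sup>2)"

definition hinner :: "complex^'m \<Rightarrow> complex^'m \<Rightarrow> complex" where
  "hinner x y = (\<Sum>j\<in>UNIV. x $ j * cnj (y $ j))"

definition perp :: "complex^'m \<Rightarrow> (complex^'m) set" where
  "perp x = {v. hinner v x = 0}"

definition Dsys :: "('n::finite \<Rightarrow> nat) \<Rightarrow> ('n, 'm::finite) system \<Rightarrow> complex^'m \<Rightarrow> complex^'m^'n" where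
  "Dsys d f x = (\<chi> i j. \<Sum>\<alpha>\<in>multi_idx (d i).
      f i \<alpha> * of_nat (\<alpha> j) * x $ j ^ (\<alpha> j - 1) *
      (\<Prod>k\<in>UNIV - {j}. x $ k ^ (\<alpha> k)))"

definition rank_restr :: "('n::finite \<Rightarrow> nat) \<Rightarrow> ('n, 'm::finite) system \<Rightarrow> complex^'m \<Rightarrow> nat" where
  "rank_restr d f x = vec.dim ((\<lambda>v. Dsys d f x *v v) ` perp x)"

text \<open>Condition number mu(f,x) = ||f|| * || (Df(x)|_{x^perp})^{-1} diag(sqrt(d_i) ||x||^(d_i-1)) ||.
  The map w \<mapsto> (Df(x)|_{x^perp})^{-1} diag(...) w is written via THE; it is only
  meaningful (and only used) when Df(x)|_{x^perp} is invertible, i.e. has rank n.\<close>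
definition mu :: "('n::finite \<Rightarrow> nat) \<Rightarrow> ('n, 'm::finite) system \<Rightarrow> complex^'m \<Rightarrow> real" where
  "mu d f x = bw_norm d f * onorm (\<lambda>w::complex^'n.
      THE v. v \<in> perp x \<and>
        Dsys d f x *v v = (\<chi> i. complex_of_real (sqrt (real (d i)) * norm x ^ (d i - 1)) * w $ i))"

definition dR :: "complex^'m \<Rightarrow> complex^'m \<Rightarrow> real" where
  "dR x y = arccos (cmod (hinner x y) / (norm x * norm y))"

definition sys_normalized_diff :: "('n::finite \<Rightarrow> nat) \<Rightarrow> ('n, 'm::finite) system \<Rightarrow> ('n, 'm) system \<Rightarrow> real" where
  "sys_normalized_diff d f g =
     bw_norm d (\<lambda>i \<alpha>. f i \<alpha> / complex_of_real (bw_norm d f) - g i \<alpha> / complex_of_real (bw_norm d g))"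

end

theory Submission
  imports Defs
begin

text \<open>
  With respect to the Bombieri--Weyl inner product the directional derivative f \<mapsto> Df(x)v on forms
  of degree k is represented by an explicit kernel. Differentiating the multinomial theorem once in
  each argument gives the inner product of two such kernels,
  k (\<langle>x,y\<rangle>^(k-1) \<langle>v,w\<rangle> + (k-1) \<langle>x,y\<rangle>^(k-2) \<langle>x,w\<rangle> \<langle>v,y\<rangle>).
  Normalise x, y, f and g, and choose the phase of y so that \<langle>x,y\<rangle> = cos \<theta> \<ge> 0. For v \<bottom> x let w be
  its image under the unitary rotation that takes x to y. The inner products above and
  Cauchy--Schwarz show that passing from (f,x,v) to (g,y,w) changes the normalised derivative by at
  most (\<parallel>f-g\<parallel> + sqrt(3D-2) \<theta>) \<parallel>v\<parallel>. Since 1/\<mu> is the least norm of the normalised derivative on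
  unit vectors of the orthogonal complement, 1/\<mu>(f,x) and 1/\<mu>(g,y) differ by at most
  \<parallel>f-g\<parallel> + sqrt(3D-2) \<theta>, and multiplied by \<mu>(f,x) this quantity is at most 3.504 u + v.
\<close>

section \<open>Hermitian inner product and orthogonal complements\<close>

lemma hinner_add_left: "hinner (x + y) z = hinner x z + hinner y z"
  by (simp add: hinner_def distrib_right sum.distrib)

lemma hinner_diff_left: "hinner (x - y) z = hinner x z - hinner y z"
  by (simp add: hinner_def left_diff_distrib sum_subtractf)

lemma hinner_scale_left: "hinner (a *s x) z = a * hinner x z"
  by (simp add: hinner_def sum_distrib_left mult.assoc)

lemma cnj_hinner: "cnj (hinner x y) = hinner y x"
  by (simp add: hinner_def mult.commute)

lemma hinner_diff_right: "hinner z (x - y) = hinner z x - hinner z y"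
  by (simp add: hinner_def right_diff_distrib sum_subtractf)

lemma hinner_add_right: "hinner z (x + y) = hinner z x + hinner z y"
  by (simp add: hinner_def distrib_left sum.distrib)

lemma hinner_scale_right: "hinner z (a *s x) = cnj a * hinner z x"
  by (simp add: hinner_def sum_distrib_left mult.left_commute)

lemmas hinner_simps = hinner_add_left hinner_diff_left hinner_scale_left
  hinner_add_right hinner_diff_right hinner_scale_right

lemma hinner_self: "hinner x x = of_real ((norm x)\<^sup>2)"
proof -
  have "(norm x)\<^sup>2 = (\<Sum>j\<in>UNIV. (cmod (x $ j))\<^sup>2)"
    by (simp add: norm_vec_def L2_set_def sum_nonneg)
  then show ?thesis
    by (simp add: hinner_def flip: complex_norm_square)
qed

lemma hinner_zero: "hinner z 0 = 0" "hinner 0 z = 0"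
  by (simp_all add: hinner_def)

lemma norm_sq_eq_Re_hinner: "(norm x)\<^sup>2 = Re (hinner x x)"
  by (simp add: hinner_self)

lemma hinner_Cauchy_Schwarz: "cmod (hinner x y) \<le> norm x * norm y"
proof -
  have "cmod (hinner x y) \<le> (\<Sum>j\<in>UNIV. \<bar>norm (x $ j)\<bar> * \<bar>norm (y $ j)\<bar>)"
    unfolding hinner_def by (rule order_trans[OF norm_sum]) (simp add: norm_mult)
  also have "\<dots> \<le> norm x * norm y"
    unfolding norm_vec_def by (rule L2_set_mult_ineq)
  finally show ?thesis .
qed

lemma norm_vector_smult: "norm (a *s x) = cmod a * norm (x :: complex^'m)"
  by (simp add: norm_vec_def norm_mult L2_set_right_distrib)

lemma perp_scale: "a \<noteq> 0 \<Longrightarrow> perp (a *s x) = perp x"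
  by (simp add: perp_def hinner_scale_right)

lemma subspace_perp: "vec.subspace (perp x)"
  by (rule vec.subspaceI) (auto simp: perp_def hinner_simps, simp add: hinner_def)

lemma span_perp: "vec.span (perp x) = perp x"
  by (simp add: subspace_perp)

text \<open>A nonzero x lies outside its own complement, and subtracting its projection onto x puts
  any vector into \<open>perp x\<close>; so adjoining x to \<open>perp x\<close> gives the whole
  space and raises the dimension by one.\<close>

lemma dim_perp:
  fixes x :: "complex^'m::finite"
  assumes "x \<noteq> 0"
  shows "vec.dim (perp x) + 1 = CARD('m)"
proof -
  have "x \<notin> perp x"
    using assms by (simp add: perp_def hinner_self)
  then have "vec.dim (insert x (perp x)) = vec.dim (perp x) + 1"
    by (simp add: vec.dim_insert span_perp)
  moreover have "vec.span (insert x (perp x)) = UNIV"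
  proof -
    have "z \<in> vec.span (insert x (perp x))" for z
    proof -
      define a where "a = hinner z x / hinner x x"
      have "z - a *s x \<in> perp x"
        using assms by (simp add: perp_def hinner_simps a_def hinner_self)
      then show ?thesis
        unfolding vec.span_insert span_perp by blast
    qed
    then show ?thesis by blast
  qed
  ultimately show ?thesis
    by (metis vec.dim_span vec_dim_card)
qed

section \<open>Multi-indices and the multinomial theorem\<close>

text \<open>Multi-indices supported on A, stored as functions on the whole type, so that induction
  over the set of variables A is possible.\<close>

definition support_idx :: "'m set \<Rightarrow> nat \<Rightarrow> ('m \<Rightarrow> nat) set" where
  "support_idx A k = {\<alpha>. (\<forall>j. j \<notin> A \<longrightarrow> \<alpha> j = 0) \<and> (\<Sum>j\<in>A. \<alpha> j) = k}"

text \<open>Splitting off the exponent i of the new variable a leaves total degree k - i for A. This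
  drives the inductions over A.\<close>

lemma support_idx_insert:
  assumes "finite A" "a \<notin> A"
  shows "bij_betw (\<lambda>(i, \<beta>). \<beta>(a := i)) (SIGMA i:{..k}. support_idx A (k - i))
           (support_idx (insert a A) k)"
proof (rule bij_betw_byWitness[where f' = "\<lambda>\<alpha>. (\<alpha> a, \<alpha>(a := 0))"])
  have sum_upd: "(\<Sum>j\<in>A. (\<beta>(a := i)) j) = (\<Sum>j\<in>A. \<beta> j)" for \<beta> :: "'a \<Rightarrow> nat" and i
    using assms by (intro sum.cong) auto
  show "(\<lambda>(i, \<beta>). \<beta>(a := i)) ` (SIGMA i:{..k}. support_idx A (k - i)) \<subseteq> support_idx (insert a A) k"
    using assms sum_upd by (auto simp: support_idx_def simp del: fun_upd_apply) auto
  show "(\<lambda>\<alpha>. (\<alpha> a, \<alpha>(a := 0))) ` support_idx (insert a A) k \<subseteq> (SIGMA i:{..k}. support_idx A (k - i))"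
    using assms sum_upd by (auto simp: support_idx_def simp del: fun_upd_apply) auto
qed (use assms in \<open>auto simp: support_idx_def\<close>)

lemma finite_support_idx:
  assumes "finite A"
  shows "finite (support_idx A k)"
  using assms
proof (induction A arbitrary: k rule: finite_induct)
  case empty
  have "support_idx {} k \<subseteq> {\<lambda>_. 0}"
    by (auto simp: support_idx_def)
  then show ?case by (rule finite_subset) simp
next
  case (insert a A)
  show ?case
    using bij_betw_finite[OF support_idx_insert[OF insert.hyps(1,2), of k]] insert.IH
    by (auto intro!: finite_SigmaI)
qed

text \<open>With divided powers the multinomial coefficients disappear, each term is a product over
  the variables, and adding one variable amounts to the binomial theorem.\<close>

lemma multinomial_divided_power:
  fixes z :: "'m \<Rightarrow> 'a::field_char_0"
  assumes "finite A"
  shows "(\<Sum>\<alpha>\<in>support_idx A k. \<Prod>j\<in>A. z j ^ \<alpha> j / fact (\<alpha> j)) = (\<Sum>j\<in>A. z j) ^ k / fact k"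
  using assms
proof (induction A arbitrary: k rule: finite_induct)
  case empty
  have "(support_idx {} k :: ('m \<Rightarrow> nat) set) = (if k = 0 then {\<lambda>_. 0} else {})"
    by (auto simp: support_idx_def)
  then show ?case by simp
next
  case (insert a A)
  let ?t = "\<lambda>B (\<alpha> :: 'm \<Rightarrow> nat). \<Prod>j\<in>B. z j ^ \<alpha> j / fact (\<alpha> j)"
  have upd: "?t (insert a A) (\<beta>(a := i)) = z a ^ i / fact i * ?t A \<beta>" for i \<beta>
  proof -
    have "?t A (\<beta>(a := i)) = ?t A \<beta>"
      using insert.hyps by (intro prod.cong) auto
    then show ?thesis using insert.hyps by simp
  qed
  have "(\<Sum>\<alpha>\<in>support_idx (insert a A) k. ?t (insert a A) \<alpha>)
      = (\<Sum>(i, \<beta>)\<in>(SIGMA i:{..k}. support_idx A (k - i)). z a ^ i / fact i * ?t A \<beta>)"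
    unfolding sum.reindex_bij_betw[OF support_idx_insert[OF insert.hyps(1,2)], symmetric]
    by (intro sum.cong) (auto simp: upd simp del: fun_upd_apply)
  also have "\<dots> = (\<Sum>i\<le>k. z a ^ i / fact i * ((\<Sum>j\<in>A. z j) ^ (k - i) / fact (k - i)))"
    unfolding insert.IH[symmetric] sum_distrib_left
    by (rule sum.Sigma[symmetric]) (auto simp: finite_support_idx insert.hyps)
  also have "\<dots> = (\<Sum>i\<le>k. of_nat (k choose i) * z a ^ i * (\<Sum>j\<in>A. z j) ^ (k - i)) / fact k"
    unfolding sum_divide_distrib
    by (intro sum.cong) (auto simp: binomial_fact)
  also have "\<dots> = (\<Sum>j\<in>insert a A. z j) ^ k / fact k"
    using insert.hyps by (simp add: binomial_ring)
  finally show ?case .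
qed

lemma multi_idx_eq_support_idx: "multi_idx k = support_idx UNIV k"
  by (simp add: multi_idx_def support_idx_def)

lemma finite_multi_idx: "finite (multi_idx k)"
  by (simp add: multi_idx_eq_support_idx finite_support_idx)

text \<open>Reciprocal of the multinomial coefficient. The degree is read off from \<alpha>, which
  agrees with the weight in \<open>bw_norm\<close> for \<alpha> in
  \<open>multi_idx (d i)\<close>.\<close>

definition bw_weight :: "('m::finite \<Rightarrow> nat) \<Rightarrow> real" where
  "bw_weight \<alpha> = real (\<Prod>j\<in>UNIV. fact (\<alpha> j)) / fact (\<Sum>j\<in>UNIV. \<alpha> j)"

lemma bw_weight_pos: "bw_weight \<alpha> > 0"
  by (simp add: bw_weight_def prod_pos)

text \<open>For c the conjugate of y this is the reproducing kernel \<open>hinner x y ^ k\<close> of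
  evaluation. Leaving out the conjugation keeps both sides polynomial in c, so that they can be
  differentiated in c as well.\<close>

lemma multinomial_theorem:
  fixes x c :: "complex^'m::finite"
  shows "(\<Sum>\<alpha>\<in>multi_idx k. (\<Prod>j\<in>UNIV. x $ j ^ \<alpha> j) * (\<Prod>j\<in>UNIV. c $ j ^ \<alpha> j) / of_real (bw_weight \<alpha>))
       = (\<Sum>j\<in>UNIV. x $ j * c $ j) ^ k"
proof -
  have "(\<Prod>j\<in>UNIV. x $ j ^ \<alpha> j) * (\<Prod>j\<in>UNIV. c $ j ^ \<alpha> j) / of_real (bw_weight \<alpha>)
      = fact k * (\<Prod>j\<in>UNIV. (x $ j * c $ j) ^ \<alpha> j / fact (\<alpha> j))" if "\<alpha> \<in> multi_idx k" for \<alpha>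
    using that
    by (simp add: bw_weight_def multi_idx_def prod_dividef power_mult_distrib prod.distrib)
  then show ?thesis
    using multinomial_divided_power[of UNIV "\<lambda>j. x $ j * c $ j" k]
    by (simp add: multi_idx_eq_support_idx sum_distrib_left[symmetric])
qed

section \<open>Derivatives of monomials and the inner products of their kernels\<close>

text \<open>Directional derivative of the monomial with exponent \<alpha> at x along v. The
  truncated exponent for \<open>\<alpha> j = 0\<close> is harmless because of the factor
  \<open>\<alpha> j\<close>.\<close>

definition monom_deriv :: "('m::finite \<Rightarrow> nat) \<Rightarrow> complex^'m \<Rightarrow> complex^'m \<Rightarrow> complex" where
  "monom_deriv \<alpha> x v = (\<Sum>j\<in>UNIV. of_nat (\<alpha> j) * x $ j ^ (\<alpha> j - 1) *
      (\<Prod>k\<in>UNIV - {j}. x $ k ^ \<alpha> k) * v $ j)"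

lemma DERIV_monom:
  "((\<lambda>t. \<Prod>j\<in>UNIV. (x + t *s v) $ j ^ \<alpha> j) has_field_derivative monom_deriv \<alpha> x v) (at 0)"
proof -
  have *: "((\<lambda>t. (x $ j + t * v $ j) ^ \<alpha> j) has_field_derivative
      of_nat (\<alpha> j) * x $ j ^ (\<alpha> j - 1) * v $ j) (at 0)" for j
    by (auto intro!: derivative_eq_intros)
  show ?thesis
    by (rule DERIV_cong[OF has_field_derivative_prod])
       (use * in \<open>auto simp: monom_deriv_def algebra_simps\<close>)
qed

text \<open>Both sides are the derivative at t = 0 of \<open>multinomial_theorem\<close> with x + tv
  in place of x.\<close>

lemma gram_mixed:
  fixes x v c :: "complex^'m::finite"
  shows "(\<Sum>\<alpha>\<in>multi_idx k. monom_deriv \<alpha> x v * (\<Prod>j\<in>UNIV. c $ j ^ \<alpha> j) / of_real (bw_weight \<alpha>))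
       = of_nat k * (\<Sum>j\<in>UNIV. x $ j * c $ j) ^ (k - 1) * (\<Sum>j\<in>UNIV. v $ j * c $ j)"
proof (rule DERIV_unique)
  let ?F = "\<lambda>t. \<Sum>\<alpha>\<in>multi_idx k. (\<Prod>j\<in>UNIV. (x + t *s v) $ j ^ \<alpha> j) * (\<Prod>j\<in>UNIV. c $ j ^ \<alpha> j) / of_real (bw_weight \<alpha>)"
  show "(?F has_field_derivative
      (\<Sum>\<alpha>\<in>multi_idx k. monom_deriv \<alpha> x v * (\<Prod>j\<in>UNIV. c $ j ^ \<alpha> j) / of_real (bw_weight \<alpha>))) (at 0)"
    by (intro DERIV_sum DERIV_cdivide DERIV_cmult_right DERIV_monom)
  have "?F = (\<lambda>t. ((\<Sum>j\<in>UNIV. x $ j * c $ j) + t * (\<Sum>j\<in>UNIV. v $ j * c $ j)) ^ k)"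
    by (simp only: multinomial_theorem)
       (simp add: distrib_right sum.distrib sum_distrib_left mult.assoc)
  then show "(?F has_field_derivative
      of_nat k * (\<Sum>j\<in>UNIV. x $ j * c $ j) ^ (k - 1) * (\<Sum>j\<in>UNIV. v $ j * c $ j)) (at 0)"
    by (auto intro!: derivative_eq_intros)
qed

text \<open>Differentiates \<open>gram_mixed\<close> once more, now along c + te. For k = 1 the
  factor k - 1 kills the term with the truncated exponent k - 2.\<close>

lemma gram_bilinear:
  fixes x v c e :: "complex^'m::finite"
  shows "(\<Sum>\<alpha>\<in>multi_idx k. monom_deriv \<alpha> x v * monom_deriv \<alpha> c e / of_real (bw_weight \<alpha>))
       = of_nat k * ((\<Sum>j\<in>UNIV. x $ j * c $ j) ^ (k - 1) * (\<Sum>j\<in>UNIV. v $ j * e $ j)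
         + of_nat (k - 1) * (\<Sum>j\<in>UNIV. x $ j * c $ j) ^ (k - 2) *
           (\<Sum>j\<in>UNIV. x $ j * e $ j) * (\<Sum>j\<in>UNIV. v $ j * c $ j))"
proof (rule DERIV_unique)
  let ?F = "\<lambda>t. \<Sum>\<alpha>\<in>multi_idx k. monom_deriv \<alpha> x v * (\<Prod>j\<in>UNIV. (c + t *s e) $ j ^ \<alpha> j) / of_real (bw_weight \<alpha>)"
  show "(?F has_field_derivative
      (\<Sum>\<alpha>\<in>multi_idx k. monom_deriv \<alpha> x v * monom_deriv \<alpha> c e / of_real (bw_weight \<alpha>))) (at 0)"
    by (intro DERIV_sum DERIV_cdivide DERIV_cmult DERIV_monom)
  have "?F = (\<lambda>t. of_nat k * ((\<Sum>j\<in>UNIV. x $ j * c $ j) + t * (\<Sum>j\<in>UNIV. x $ j * e $ j)) ^ (k - 1)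
      * ((\<Sum>j\<in>UNIV. v $ j * c $ j) + t * (\<Sum>j\<in>UNIV. v $ j * e $ j)))"
    by (simp only: gram_mixed)
       (simp add: distrib_left sum.distrib sum_distrib_left mult.left_commute)
  then show "(?F has_field_derivative
      of_nat k * ((\<Sum>j\<in>UNIV. x $ j * c $ j) ^ (k - 1) * (\<Sum>j\<in>UNIV. v $ j * e $ j)
         + of_nat (k - 1) * (\<Sum>j\<in>UNIV. x $ j * c $ j) ^ (k - 2) *
           (\<Sum>j\<in>UNIV. x $ j * e $ j) * (\<Sum>j\<in>UNIV. v $ j * c $ j))) (at 0)"
    by (auto intro!: derivative_eq_intros simp: algebra_simps numeral_2_eq_2)
qed

text \<open>Conjugating the second pair of arguments entrywise turns the bilinear formula into the
  Hermitian one.\<close>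

lemma gram:
  "(\<Sum>\<alpha>\<in>multi_idx k. monom_deriv \<alpha> x v * cnj (monom_deriv \<alpha> y w) / of_real (bw_weight \<alpha>))
     = of_nat k * (hinner x y ^ (k - 1) * hinner v w
         + of_nat (k - 1) * hinner x y ^ (k - 2) * hinner x w * hinner v y)"
proof -
  have "cnj (monom_deriv \<alpha> y w) = monom_deriv \<alpha> (\<chi> j. cnj (y $ j)) (\<chi> j. cnj (w $ j))" for \<alpha>
    by (simp add: monom_deriv_def)
  then show ?thesis
    by (simp add: gram_bilinear hinner_def)
qed

text \<open>The squared distance of the two derivative kernels: expand the square and apply
  \<open>gram\<close> to the two diagonal terms and the cross term.\<close>

lemma gram_dist:
  "(\<Sum>\<alpha>\<in>multi_idx k. (cmod (monom_deriv \<alpha> y w - monom_deriv \<alpha> x v))\<^sup>2 / bw_weight \<alpha>)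
     = k * Re ((hinner y y ^ (k - 1) * hinner w w
         + of_nat (k - 1) * hinner y y ^ (k - 2) * hinner y w * hinner w y)
       + (hinner x x ^ (k - 1) * hinner v v
         + of_nat (k - 1) * hinner x x ^ (k - 2) * hinner x v * hinner v x)
       - 2 * (hinner x y ^ (k - 1) * hinner v w
         + of_nat (k - 1) * hinner x y ^ (k - 2) * hinner x w * hinner v y))"
proof -
  have "(cmod (monom_deriv \<alpha> y w - monom_deriv \<alpha> x v))\<^sup>2 / bw_weight \<alpha>
      = Re (monom_deriv \<alpha> y w * cnj (monom_deriv \<alpha> y w) / of_real (bw_weight \<alpha>)
          + monom_deriv \<alpha> x v * cnj (monom_deriv \<alpha> x v) / of_real (bw_weight \<alpha>)
          - 2 * (monom_deriv \<alpha> x v * cnj (monom_deriv \<alpha> y w) / of_real (bw_weight \<alpha>)))" for \<alpha>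
    unfolding cmod_power2
    by (simp add: field_simps bw_weight_pos[THEN less_imp_neq, symmetric] power2_eq_square)
  then have "(\<Sum>\<alpha>\<in>multi_idx k. (cmod (monom_deriv \<alpha> y w - monom_deriv \<alpha> x v))\<^sup>2 / bw_weight \<alpha>)
      = Re ((\<Sum>\<alpha>\<in>multi_idx k. monom_deriv \<alpha> y w * cnj (monom_deriv \<alpha> y w) / of_real (bw_weight \<alpha>))
          + (\<Sum>\<alpha>\<in>multi_idx k. monom_deriv \<alpha> x v * cnj (monom_deriv \<alpha> x v) / of_real (bw_weight \<alpha>))
          - 2 * (\<Sum>\<alpha>\<in>multi_idx k. monom_deriv \<alpha> x v * cnj (monom_deriv \<alpha> y w) / of_real (bw_weight \<alpha>)))"
    by (simp only: Re_sum[symmetric] sum.distrib sum_subtractf sum_distrib_left)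
  moreover have "Re (of_nat k * A + of_nat k * B - 2 * (of_nat k * C)) = real k * Re (A + B - 2 * C)" for A B C
    by (simp add: algebra_simps)
  ultimately show ?thesis
    unfolding gram by (simp only:)
qed

section \<open>The Bombieri-Weyl norm and the normalised derivative\<close>

text \<open>Cauchy-Schwarz after splitting each weight as \<open>sqrt (p i)\<close> times its
  inverse. With \<open>bw_weight\<close> for p, the first factor is the squared norm of one
  polynomial of the system.\<close>

lemma cmod_sum_le_weighted:
  fixes p :: "'a \<Rightarrow> real" and a z :: "'a \<Rightarrow> complex"
  assumes "\<And>i. i \<in> S \<Longrightarrow> p i > 0"
  shows "(cmod (\<Sum>i\<in>S. a i * z i))\<^sup>2 \<le> (\<Sum>i\<in>S. p i * (cmod (a i))\<^sup>2) * (\<Sum>i\<in>S. (cmod (z i))\<^sup>2 / p i)"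
proof -
  have "cmod (\<Sum>i\<in>S. a i * z i) \<le> (\<Sum>i\<in>S. (sqrt (p i) * cmod (a i)) * (cmod (z i) / sqrt (p i)))"
    by (rule order_trans[OF norm_sum], rule sum_mono) (use assms in \<open>force simp: norm_mult\<close>)
  then have "(cmod (\<Sum>i\<in>S. a i * z i))\<^sup>2 \<le> (\<Sum>i\<in>S. (sqrt (p i) * cmod (a i)) * (cmod (z i) / sqrt (p i)))\<^sup>2"
    by (intro power_mono) auto
  also have "\<dots> \<le> (\<Sum>i\<in>S. (sqrt (p i) * cmod (a i))\<^sup>2) * (\<Sum>i\<in>S. (cmod (z i) / sqrt (p i))\<^sup>2)"
    by (rule Cauchy_Schwarz_ineq_sum)
  also have "\<dots> = (\<Sum>i\<in>S. p i * (cmod (a i))\<^sup>2) * (\<Sum>i\<in>S. (cmod (z i))\<^sup>2 / p i)"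
    using assms by (intro arg_cong2[where f = "(*)"] sum.cong)
      (auto simp: power_mult_distrib power_divide less_imp_le)
  finally show ?thesis .
qed

lemma bw_norm_weight:
  "bw_norm d f = sqrt (\<Sum>i\<in>UNIV. \<Sum>\<alpha>\<in>multi_idx (d i). bw_weight \<alpha> * (cmod (f i \<alpha>))\<^sup>2)"
  unfolding bw_norm_def
  by (intro arg_cong[where f = sqrt] sum.cong) (auto simp: bw_weight_def multi_idx_def)

lemma bw_norm_sq:
  "(bw_norm d f)\<^sup>2 = (\<Sum>i\<in>UNIV. \<Sum>\<alpha>\<in>multi_idx (d i). bw_weight \<alpha> * (cmod (f i \<alpha>))\<^sup>2)"
  by (simp add: bw_norm_weight sum_nonneg bw_weight_pos less_imp_le)

lemma bw_norm_nonneg: "bw_norm d f \<ge> 0"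
  by (simp add: bw_norm_weight sum_nonneg bw_weight_pos less_imp_le)

lemma bw_norm_pos:
  assumes "sys_nonzero d f"
  shows "bw_norm d f > 0"
proof -
  obtain i \<alpha> where i: "\<alpha> \<in> multi_idx (d i)" "f i \<alpha> \<noteq> 0"
    using assms by (auto simp: sys_nonzero_def)
  have "0 < (\<Sum>\<alpha>\<in>multi_idx (d i). bw_weight \<alpha> * (cmod (f i \<alpha>))\<^sup>2)"
    by (rule sum_pos2[OF finite_multi_idx i(1)]) (use i in \<open>auto simp: bw_weight_pos less_imp_le\<close>)
  then have "0 < (\<Sum>i\<in>UNIV. \<Sum>\<alpha>\<in>multi_idx (d i). bw_weight \<alpha> * (cmod (f i \<alpha>))\<^sup>2)"
    by (intro sum_pos2[of UNIV i]) (auto simp: sum_nonneg bw_weight_pos less_imp_le)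
  then show ?thesis
    by (simp add: bw_norm_weight)
qed

lemma bw_norm_diff_commute:
  "bw_norm d (\<lambda>i \<alpha>. f i \<alpha> - g i \<alpha>) = bw_norm d (\<lambda>i \<alpha>. g i \<alpha> - f i \<alpha>)"
  by (simp add: bw_norm_weight norm_minus_commute)

lemma Dsys_mult_component:
  "(Dsys d f x *v v) $ i = (\<Sum>\<alpha>\<in>multi_idx (d i). f i \<alpha> * monom_deriv \<alpha> x v)"
  unfolding matrix_vector_mult_def Dsys_def monom_deriv_def
  by (simp add: sum_distrib_left sum_distrib_right mult.assoc) (rule sum.swap)

text \<open>On \<open>perp x\<close> this is the inverse of the operator inside \<open>mu\<close>,
  when that inverse exists. The diagonal scaling makes its norm independent of the representative of
  the projective point x.\<close>

definition normalized_deriv ::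
  "('n::finite \<Rightarrow> nat) \<Rightarrow> ('n, 'm::finite) system \<Rightarrow> complex^'m \<Rightarrow> complex^'m \<Rightarrow> complex^'n" where
  "normalized_deriv d f x v =
     (\<chi> i. (Dsys d f x *v v) $ i / of_real (sqrt (real (d i)) * norm x ^ (d i - 1)))"

lemma normalized_deriv_diff:
  "normalized_deriv d (\<lambda>i \<alpha>. f i \<alpha> - g i \<alpha>) x v = normalized_deriv d f x v - normalized_deriv d g x v"
  by (simp add: normalized_deriv_def Dsys_mult_component vec_eq_iff left_diff_distrib
      sum_subtractf diff_divide_distrib)

lemma norm_normalized_deriv_divide:
  assumes "a > 0"
  shows "norm (normalized_deriv d (\<lambda>i \<alpha>. f i \<alpha> / of_real a) x v) = norm (normalized_deriv d f x v) / a"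
proof -
  have "normalized_deriv d (\<lambda>i \<alpha>. f i \<alpha> / of_real a) x v = of_real (1 / a) *s normalized_deriv d f x v"
    by (simp add: normalized_deriv_def Dsys_mult_component vec_eq_iff sum_divide_distrib mult.commute)
  then show ?thesis
    using assms by (simp add: norm_vector_smult norm_divide)
qed

text \<open>The first derivatives of a form of degree k are homogeneous of degree k - 1.\<close>

lemma monom_deriv_scale:
  assumes "\<alpha> \<in> multi_idx k"
  shows "monom_deriv \<alpha> (a *s x) v = a ^ (k - 1) * monom_deriv \<alpha> x v"
  unfolding monom_deriv_def sum_distrib_left
proof (rule sum.cong)
  fix j :: 'a
  show "of_nat (\<alpha> j) * (a *s x) $ j ^ (\<alpha> j - 1) * (\<Prod>k\<in>UNIV - {j}. (a *s x) $ k ^ \<alpha> k) * v $ j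
     = a ^ (k - 1) * (of_nat (\<alpha> j) * x $ j ^ (\<alpha> j - 1) * (\<Prod>k\<in>UNIV - {j}. x $ k ^ \<alpha> k) * v $ j)"
  \<comment> \<open>If \<open>\<alpha> j = 0\<close> both sides vanish; otherwise
    \<open>\<alpha> j - 1\<close> is a true subtraction and the remaining exponents add up to k -
    1.\<close>
  proof (cases "\<alpha> j = 0")
    case False
    have "k = \<alpha> j + (\<Sum>i\<in>UNIV - {j}. \<alpha> i)"
      using assms by (simp add: multi_idx_def sum.remove[of UNIV j])
    then have "k - 1 = (\<alpha> j - 1) + (\<Sum>i\<in>UNIV - {j}. \<alpha> i)"
      using False by simp
    then have "a ^ (k - 1) = a ^ (\<alpha> j - 1) * (\<Prod>i\<in>UNIV - {j}. a ^ \<alpha> i)"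
      by (simp add: power_add power_sum)
    then show ?thesis
      by (simp add: power_mult_distrib prod.distrib mult_ac)
  qed simp
qed simp

lemma norm_normalized_deriv_scale:
  assumes "a \<noteq> 0"
  shows "norm (normalized_deriv d f (a *s x) v) = norm (normalized_deriv d f x v)"
proof -
  have "(Dsys d f (a *s x) *v v) $ i = a ^ (d i - 1) * (Dsys d f x *v v) $ i" for i
    by (simp add: Dsys_mult_component monom_deriv_scale sum_distrib_left mult.left_commute)
  then have "cmod (normalized_deriv d f (a *s x) v $ i) = cmod (normalized_deriv d f x v $ i)" for i
    using assms
    by (simp add: normalized_deriv_def norm_vector_smult norm_divide norm_mult norm_power
        power_mult_distrib)
  then show ?thesis
    by (simp add: norm_vec_def)
qed

text \<open>Cauchy-Schwarz in each component: the factor \<open>d i\<close> of the hypothesis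
  cancels the square of the normalising \<open>sqrt (d i)\<close>, and summing over i assembles the
  norm of f.\<close>

lemma norm_normalized_deriv_diff_le:
  fixes K :: real
  assumes d: "\<And>i. d i > 0" and nx: "norm x = 1" "norm y = 1" and K: "K \<ge> 0"
    and le: "\<And>i. (\<Sum>\<alpha>\<in>multi_idx (d i). (cmod (monom_deriv \<alpha> y w - monom_deriv \<alpha> x v))\<^sup>2 / bw_weight \<alpha>)
               \<le> d i * K\<^sup>2"
  shows "norm (normalized_deriv d f y w - normalized_deriv d f x v) \<le> bw_norm d f * K"
proof (rule power2_le_imp_le)
  let ?F = "\<lambda>i. \<Sum>\<alpha>\<in>multi_idx (d i). bw_weight \<alpha> * (cmod (f i \<alpha>))\<^sup>2"
  have comp: "(cmod ((normalized_deriv d f y w - normalized_deriv d f x v) $ i))\<^sup>2 \<le> ?F i * K\<^sup>2" for i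
  proof -
    have "(normalized_deriv d f y w - normalized_deriv d f x v) $ i
        = (\<Sum>\<alpha>\<in>multi_idx (d i). f i \<alpha> * (monom_deriv \<alpha> y w - monom_deriv \<alpha> x v)) / of_real (sqrt (d i))"
      by (simp add: normalized_deriv_def nx Dsys_mult_component right_diff_distrib sum_subtractf
          diff_divide_distrib)
    then have "(cmod ((normalized_deriv d f y w - normalized_deriv d f x v) $ i))\<^sup>2
        = (cmod (\<Sum>\<alpha>\<in>multi_idx (d i). f i \<alpha> * (monom_deriv \<alpha> y w - monom_deriv \<alpha> x v)))\<^sup>2 / d i"
      by (simp add: norm_divide power_divide)
    also have "\<dots> \<le> ?F i * (d i * K\<^sup>2) / d i"
      by (intro divide_right_mono order_trans[OF cmod_sum_le_weighted mult_left_mono] le)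
         (auto simp: bw_weight_pos less_imp_le sum_nonneg)
    finally show ?thesis
      using d[of i] by simp
  qed
  have "(norm (normalized_deriv d f y w - normalized_deriv d f x v))\<^sup>2
      = (\<Sum>i\<in>UNIV. (cmod ((normalized_deriv d f y w - normalized_deriv d f x v) $ i))\<^sup>2)"
    by (simp add: norm_vec_def L2_set_def sum_nonneg)
  also have "\<dots> \<le> (\<Sum>i\<in>UNIV. ?F i * K\<^sup>2)"
    by (intro sum_mono comp)
  also have "\<dots> = (bw_norm d f * K)\<^sup>2"
    by (simp add: power_mult_distrib bw_norm_sq sum_distrib_right)
  finally show "(norm (normalized_deriv d f y w - normalized_deriv d f x v))\<^sup>2 \<le> (bw_norm d f * K)\<^sup>2" .
qed (simp add: K bw_norm_nonneg)

text \<open>Compares w with the zero direction at the same point. As w is orthogonal to y, the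
  second term of the kernel formula drops out and the squared distance is k times the squared norm
  of w.\<close>

lemma norm_normalized_deriv_le:
  assumes d: "\<And>i. d i > 0" and ny: "norm y = 1" and w: "w \<in> perp y"
  shows "norm (normalized_deriv d f y w) \<le> bw_norm d f * norm w"
proof -
  have wy: "hinner w y = 0" "hinner y w = 0"
    using w cnj_hinner[of w y] by (auto simp: perp_def)
  have "norm (normalized_deriv d f y w - normalized_deriv d f y 0) \<le> bw_norm d f * norm w"
    by (rule norm_normalized_deriv_diff_le[OF d ny ny])
       (simp_all add: gram_dist hinner_self ny wy hinner_zero flip: of_real_power)
  then show ?thesis
    by (simp add: normalized_deriv_def flip: zero_vec_def)
qed

section \<open>Rotation of tangent vectors from x to y\<close>

text \<open>The vector w is the image of v under the rotation in the plane of x and y that takes x to y.\<close>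

context
  fixes x y v w :: "complex^'m::finite" and c :: real
  assumes nx: "norm x = 1" and ny: "norm y = 1"
    and xy: "hinner x y = of_real c" and c: "c \<ge> 0"
    and v: "v \<in> perp x"
  defines "w \<equiv> v - (hinner v y / of_real (1 + c)) *s (x + y)"
begin

text \<open>All four follow from the defining relation a(1 + c) = \<open>hinner v y\<close> and the
  orthogonality of v to x. They are the inner products that \<open>gram_dist\<close> asks
  for.\<close>

lemma transport_inner:
  shows "hinner y w = 0" "hinner w y = 0" "hinner x w = - cnj (hinner v y)"
    "hinner v w = of_real ((norm v)\<^sup>2 - (cmod (hinner v y))\<^sup>2 / (1 + c))"
proof -
  define a where "a = hinner v y / of_real (1 + c)"
  \<comment> \<open>This is where the choice of phase pays off: a nonnegative c keeps 1 + c away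
    from zero.\<close>
  have "complex_of_real (1 + c) \<noteq> 0"
    using c by (simp only: of_real_eq_0_iff)
  then have a: "a * of_real c + a = hinner v y"
    by (simp add: a_def add.commute flip: distrib_left[of a _ 1, simplified])
  have vx: "hinner v x = 0" "hinner x v = 0"
    using v cnj_hinner[of v x] by (auto simp: perp_def)
  have w: "w = v - a *s (x + y)"
    by (simp add: w_def a_def)
  show "hinner w y = 0"
    by (simp add: w hinner_simps hinner_self ny xy distrib_left a[symmetric])
  then show "hinner y w = 0"
    using cnj_hinner[of w y] by simp
  show "hinner x w = - cnj (hinner v y)"
    by (simp add: w hinner_simps hinner_self nx xy vx distrib_left a[symmetric])
  have "hinner v w = of_real ((norm v)\<^sup>2) - cnj a * hinner v y"
    by (simp add: w hinner_simps hinner_self vx)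
  also have "cnj a * hinner v y = of_real ((cmod (hinner v y))\<^sup>2 / (1 + c))"
    unfolding a_def of_real_divide complex_norm_square by simp
  finally show "hinner v w = of_real ((norm v)\<^sup>2 - (cmod (hinner v y))\<^sup>2 / (1 + c))"
    by simp
qed

lemma transport_perp: "w \<in> perp y"
  by (simp add: perp_def transport_inner)

text \<open>The term that \<open>hinner v w\<close> loses against the squared norm of v is restored
  by the contribution of \<open>hinner x w\<close>, while \<open>hinner y w\<close>
  vanishes.\<close>

lemma norm_transport: "norm w = norm v"
proof -
  have "hinner w w = hinner v w - hinner v y / of_real (1 + c) * (hinner x w + hinner y w)"
    unfolding w_def hinner_diff_left hinner_scale_left hinner_add_left ..
  also have "\<dots> = of_real ((norm v)\<^sup>2)"
    unfolding transport_inner of_real_diff of_real_divide complex_norm_square[of "hinner v y"]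
    by simp
  finally show ?thesis
    by (simp add: hinner_self del: of_real_power)
qed

text \<open>After inserting the inner products, three defects remain. They are at most k - 1, 1 and
  2(k - 1) times (1 - c)V, and these coefficients add up to 3k - 2.\<close>

lemma transport_monom_deriv_dist:
  assumes k: "k > 0"
  shows "(\<Sum>\<alpha>\<in>multi_idx k. (cmod (monom_deriv \<alpha> y w - monom_deriv \<alpha> x v))\<^sup>2 / bw_weight \<alpha>)
     \<le> k * ((3 * real k - 2) * (2 * (1 - c)) * (norm v)\<^sup>2)"
proof -
  define V where "V = (norm v)\<^sup>2"
  define B where "B = (cmod (hinner v y))\<^sup>2"
  have vx: "hinner v x = 0" "hinner x v = 0"
    using v cnj_hinner[of v x] by (auto simp: perp_def)
  have c1: "c \<le> 1"
    using hinner_Cauchy_Schwarz[of x y] c by (simp add: nx ny xy)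
  have yx: "hinner y x = of_real c"
    using cnj_hinner[of x y] xy by simp
  \<comment> \<open>Since v is orthogonal to x, it only sees the component of y orthogonal to x,
    whose squared norm is 1 - c^2.\<close>
  have B: "B \<le> (1 - c\<^sup>2) * V"
  proof -
    let ?z = "y - of_real c *s x"
    have "hinner ?z ?z = of_real (1 - c\<^sup>2)"
      unfolding hinner_simps hinner_self[of x] hinner_self[of y] nx ny xy yx
      by (simp add: power2_eq_square)
    then have z: "(norm ?z)\<^sup>2 = 1 - c\<^sup>2"
      by (simp only: norm_sq_eq_Re_hinner Re_complex_of_real)
    have "cmod (hinner v y) = cmod (hinner v ?z)"
      by (simp add: hinner_simps vx)
    also have "\<dots> \<le> norm v * norm ?z"
      by (rule hinner_Cauchy_Schwarz)
    finally have "B \<le> (norm v * norm ?z)\<^sup>2"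
      unfolding B_def by (intro power_mono) auto
    then show ?thesis
      by (simp add: power_mult_distrib z V_def mult.commute)
  qed
  have V0: "V \<ge> 0" and B0: "B \<ge> 0" by (simp_all add: V_def B_def)
  have "(\<Sum>\<alpha>\<in>multi_idx k. (cmod (monom_deriv \<alpha> y w - monom_deriv \<alpha> x v))\<^sup>2 / bw_weight \<alpha>)
      = k * Re (of_real V + of_real V - 2 * (of_real c ^ (k - 1) * of_real (V - B / (1 + c))
          + of_nat (k - 1) * of_real c ^ (k - 2) * (- of_real B)))"
  proof -
    have "hinner x w * hinner v y = - of_real B"
      by (simp add: transport_inner B_def mult.commute flip: complex_norm_square)
    then show ?thesis
      unfolding gram_dist mult.assoc
      by (simp add: vx transport_inner(1,2,4) xy hinner_self nx ny norm_transport flip: V_def B_def)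
  qed
  also have "\<dots> = k * Re (of_real (2 * (V - c ^ (k - 1) * (V - B / (1 + c)) + real (k - 1) * c ^ (k - 2) * B)))"
    by (simp add: algebra_simps)
  also have "\<dots> \<le> k * ((3 * real k - 2) * (2 * (1 - c)) * V)"
  proof -
    \<comment> \<open>Bernoulli's inequality for c = 1 + (c - 1), linearising the power of c near
      1.\<close>
    have "1 - real (k - 1) * (1 - c) \<le> c ^ (k - 1)"
      using Bernoulli_inequality[of "c - 1" "k - 1"] c by (simp add: algebra_simps)
    then have 1: "V - c ^ (k - 1) * V \<le> real (k - 1) * (1 - c) * V"
      using mult_right_mono[OF _ V0] by (fastforce simp: algebra_simps)
    have "c ^ (k - 1) * (B / (1 + c)) \<le> B / (1 + c)"
      using c c1 B0 by (intro mult_left_le_one_le power_le_one) auto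
    \<comment> \<open>The factor 1 + c of 1 - c^2 cancels the denominator.\<close>
    also have "\<dots> \<le> (1 - c) * V"
      using B c by (simp add: field_simps power2_eq_square)
    finally have 2: "c ^ (k - 1) * (B / (1 + c)) \<le> (1 - c) * V" .
    have "real (k - 1) * c ^ (k - 2) * B \<le> real (k - 1) * B"
      using c c1 B0 by (intro mult_right_mono mult_left_le power_le_one) auto
    also have "\<dots> \<le> real (k - 1) * (2 * (1 - c) * V)"
    proof (intro mult_left_mono order_trans[OF B] mult_right_mono V0)
      have "(1 - c) * (1 + c) \<le> (1 - c) * 2"
        using c1 by (intro mult_left_mono) auto
      then show "1 - c\<^sup>2 \<le> 2 * (1 - c)"
        by (simp add: algebra_simps power2_eq_square)
    qed simp
    finally have 3: "real (k - 1) * c ^ (k - 2) * B \<le> real (k - 1) * (2 * (1 - c) * V)" .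
    have "V - c ^ (k - 1) * (V - B / (1 + c)) + real (k - 1) * c ^ (k - 2) * B
        \<le> real (k - 1) * (1 - c) * V + (1 - c) * V + real (k - 1) * (2 * (1 - c) * V)"
      using 1 2 3 by (simp add: right_diff_distrib)
    also have "\<dots> = (3 * real k - 2) * (1 - c) * V"
      using k by (simp add: of_nat_diff algebra_simps)
    finally have "2 * (V - c ^ (k - 1) * (V - B / (1 + c)) + real (k - 1) * c ^ (k - 2) * B)
        \<le> 2 * ((3 * real k - 2) * (1 - c) * V)"
      by (rule mult_left_mono) simp
    also have "\<dots> = (3 * real k - 2) * (2 * (1 - c)) * V"
      by (simp only: mult_ac)
    finally show ?thesis
      unfolding Re_complex_of_real by (rule mult_left_mono) simp
  qed
  finally show ?thesis
    by (simp add: V_def)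
qed

end

section \<open>Comparison of normalised derivatives at two points\<close>

text \<open>Rescaling reduces to unit vectors with nonnegative inner product. The passage goes
  through the intermediate triple (f, y, w): first the point moves with f fixed, then f is replaced
  by g at y.\<close>

lemma exists_transported_vector:
  fixes x y :: "complex^'m::finite"
  assumes d: "\<And>i. d i > 0" and D: "\<And>i. d i \<le> D"
    and x: "x \<noteq> 0" and y: "y \<noteq> 0" and v: "v \<in> perp x"
  obtains w where "w \<in> perp y" "norm w = norm v"
    "\<bar>norm (normalized_deriv d f x v) - norm (normalized_deriv d g y w)\<bar>
       \<le> (bw_norm d (\<lambda>i \<alpha>. f i \<alpha> - g i \<alpha>) + sqrt (3 * real D - 2) * bw_norm d f * dR x y) * norm v"
proof -
  define c where "c = cmod (hinner x y) / (norm x * norm y)"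
  have c0: "c \<ge> 0" by (simp add: c_def)
  have c1: "c \<le> 1"
    using x y hinner_Cauchy_Schwarz[of x y] by (simp add: c_def)
  \<comment> \<open>The phase of the inner product, absorbed into y below. If x and y are orthogonal
    any phase will do.\<close>
  define p where "p = (if hinner x y = 0 then 1 else sgn (hinner x y))"
  have p: "cmod p = 1" "hinner x y * cnj p = cmod (hinner x y)"
  proof -
    show "cmod p = 1" by (simp add: p_def norm_sgn)
    show "hinner x y * cnj p = cmod (hinner x y)"
      by (auto simp: p_def sgn_eq power2_eq_square simp flip: complex_norm_square)
  qed
  define x' where "x' = of_real (1 / norm x) *s x"
  define y' where "y' = (p / of_real (norm y)) *s y"
  have p0: "p \<noteq> 0" using p(1) by auto
  have nx: "norm x' = 1" and ny: "norm y' = 1"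
    using x y p(1) by (simp_all add: x'_def y'_def norm_vector_smult norm_divide)
  have xy: "hinner x' y' = of_real c"
    using p(2) by (simp add: x'_def y'_def hinner_simps c_def mult.commute)
  have px: "perp x' = perp x" and py: "perp y' = perp y"
    using x y p0 by (simp_all add: x'_def y'_def perp_scale)
  have v': "v \<in> perp x'" using v px by simp
  define w where "w = v - (hinner v y' / of_real (1 + c)) *s (x' + y')"
  have wp: "w \<in> perp y'" and nw: "norm w = norm v"
    unfolding w_def using transport_perp[OF nx ny xy c0 v'] norm_transport[OF nx ny xy c0 v'] by auto
  \<comment> \<open>Any one equation of positive degree shows that D is at least 1;
    \<open>undefined\<close> merely names an index.\<close>
  have D1: "3 * real D - 2 \<ge> 0"
    using d[of undefined] D[of undefined] by linarith
  define \<theta> where "\<theta> = dR x y"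
  have \<theta>: "\<theta> \<ge> 0" "cos \<theta> = c"
    using c0 c1 by (auto simp: \<theta>_def dR_def c_def[symmetric] intro!: arccos_lbound cos_arccos)
  \<comment> \<open>For unit vectors with inner product c this compares chord and arc: 2(1 - c) = 4
    sin^2(\<theta>/2).\<close>
  have cos_le: "2 * (1 - c) \<le> \<theta>\<^sup>2"
  proof -
    have "c = 1 - 2 * (sin (\<theta> / 2))\<^sup>2"
      using cos_double_sin[of "\<theta> / 2"] \<theta>(2) by simp
    moreover have "(sin (\<theta> / 2))\<^sup>2 \<le> (\<theta> / 2)\<^sup>2"
      using abs_sin_x_le_abs_x[of "\<theta> / 2"] by (simp only: abs_le_square_iff)
    ultimately show ?thesis by (simp add: power2_eq_square)
  qed
  let ?K = "sqrt (3 * real D - 2) * \<theta> * norm v"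
  have "norm (normalized_deriv d f y' w - normalized_deriv d f x' v) \<le> bw_norm d f * ?K"
  proof (rule norm_normalized_deriv_diff_le[OF d nx ny])
    show "?K \<ge> 0" using \<theta> D1 by simp
    fix i
    have "(\<Sum>\<alpha>\<in>multi_idx (d i). (cmod (monom_deriv \<alpha> y' w - monom_deriv \<alpha> x' v))\<^sup>2 / bw_weight \<alpha>)
      \<le> d i * ((3 * real (d i) - 2) * (2 * (1 - c)) * (norm v)\<^sup>2)"
      unfolding w_def by (rule transport_monom_deriv_dist[OF nx ny xy c0 v' d])
    also have "\<dots> \<le> d i * ((3 * real D - 2) * \<theta>\<^sup>2 * (norm v)\<^sup>2)"
      using D[of i] D1 cos_le c1 by (intro mult_left_mono mult_right_mono mult_mono) auto
    also have "\<dots> = d i * ?K\<^sup>2"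
      using D1 by (simp add: power_mult_distrib)
    finally show "(\<Sum>\<alpha>\<in>multi_idx (d i). (cmod (monom_deriv \<alpha> y' w - monom_deriv \<alpha> x' v))\<^sup>2 / bw_weight \<alpha>)
      \<le> d i * ?K\<^sup>2" .
  qed
  moreover have "norm (normalized_deriv d f y' w - normalized_deriv d g y' w)
      \<le> bw_norm d (\<lambda>i \<alpha>. f i \<alpha> - g i \<alpha>) * norm v"
    using norm_normalized_deriv_le[OF d ny wp, where f = "\<lambda>i \<alpha>. f i \<alpha> - g i \<alpha>"]
    by (simp add: normalized_deriv_diff nw)
  ultimately have "\<bar>norm (normalized_deriv d f x' v) - norm (normalized_deriv d g y' w)\<bar>
      \<le> bw_norm d (\<lambda>i \<alpha>. f i \<alpha> - g i \<alpha>) * norm v + bw_norm d f * ?K"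
    using norm_triangle_ineq3[of "normalized_deriv d f y' w" "normalized_deriv d g y' w"]
      norm_triangle_ineq3[of "normalized_deriv d f y' w" "normalized_deriv d f x' v"]
    by linarith
  moreover have "norm (normalized_deriv d f x' v) = norm (normalized_deriv d f x v)"
    "norm (normalized_deriv d g y' w) = norm (normalized_deriv d g y w)"
    using x y p0 by (simp_all add: x'_def y'_def norm_normalized_deriv_scale)
  ultimately show thesis
    using that[of w] wp nw by (simp add: py \<theta>_def algebra_simps)
qed

section \<open>Full rank and the condition number as an operator norm\<close>

lemma rank_restr_full_right_inverse:
  fixes f :: "('n::finite, 'm::finite) system"
  assumes "rank_restr d f x = CARD('n)"
  obtains h where "Vector_Spaces.linear (*s) (*s) h" "\<forall>w. h w \<in> perp x" "\<forall>w. Dsys d f x *v h w = w"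
proof -
  let ?L = "\<lambda>v. Dsys d f x *v v"
  have "vec.dim (?L ` perp x) = vec.dim (UNIV :: (complex^'n) set)"
    using assms by (simp only: rank_restr_def vec_dim_card)
  moreover have "vec.subspace (?L ` perp x)"
    by (rule vec.subspace_image[OF subspace_perp])
  ultimately have surj: "?L ` perp x = UNIV"
    by (intro vec.subspace_dim_equal) auto
  show thesis
    using vec.linear_exists_right_inverse_on
      [OF matrix_vector_mul_linear_gen[of "Dsys d f x"] subspace_perp[of x]] that
    unfolding surj by blast
qed

text \<open>The complement of x has dimension n, so the restricted derivative is a map between
  spaces of equal dimension. A right inverse into \<open>perp x\<close> is injective, hence onto by
  dimension, which forces a trivial kernel; conversely an injective map preserves dimension.\<close>

lemma rank_restr_full_iff:
  fixes f :: "('n::finite, 'm::finite) system"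
  assumes dim: "CARD('m) = CARD('n) + 1" and x: "x \<noteq> 0"
  shows "rank_restr d f x = CARD('n) \<longleftrightarrow> (\<forall>v\<in>perp x. Dsys d f x *v v = 0 \<longrightarrow> v = 0)"
proof
  have dp: "vec.dim (perp x) = CARD('n)"
    using dim_perp[OF x] dim by simp
  let ?L = "\<lambda>v. Dsys d f x *v v"
  {
    assume "rank_restr d f x = CARD('n)"
    then obtain h where h: "Vector_Spaces.linear (*s) (*s) h" "\<forall>w. h w \<in> perp x" "\<forall>w. ?L (h w) = w"
      using rank_restr_full_right_inverse by blast
    have "inj h" using h(3) by (metis injI)
    then have "vec.dim (h ` UNIV) = CARD('n)"
      using vec.dim_image_eq[OF h(1), of UNIV] by (simp add: card_cart_basis)
    then have "h ` UNIV = perp x"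
      using dp h(2)
      by (intro vec.subspace_dim_equal subspace_perp vec.linear_subspace_image[OF h(1)]) auto
    then show "\<forall>v\<in>perp x. ?L v = 0 \<longrightarrow> v = 0"
      using h(3) vec.linear_0[OF h(1)] by (metis imageE)
  next
    assume inj0: "\<forall>v\<in>perp x. ?L v = 0 \<longrightarrow> v = 0"
    have "inj_on ?L (perp x)"
      by (subst vec.inj_on_iff_eq_0) (use inj0 subspace_perp in auto)
    then show "rank_restr d f x = CARD('n)"
      unfolding rank_restr_def dp[symmetric]
      by (intro vec.dim_image_eq matrix_vector_mul_linear_gen) (simp only: span_perp)
  }
qed

text \<open>A constant equation has zero derivative, so its component could not be hit by a
  surjective map.\<close>

lemma rank_restr_full_degree_pos:
  fixes f :: "('n::finite, 'm::finite) system"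
  assumes "rank_restr d f x = CARD('n)"
  shows "d i > 0"
proof (rule ccontr)
  assume "\<not> d i > 0"
  then have "(Dsys d f x *v v) $ i = 0" for v
    by (simp add: Dsys_mult_component multi_idx_def monom_deriv_def)
  moreover obtain h where "\<And>w. Dsys d f x *v h w = w"
    using rank_restr_full_right_inverse[OF assms] by blast
  ultimately have "(1 :: complex^'n) $ i = 0" by metis
  then show False by simp
qed

text \<open>Full rank makes the description by \<open>THE\<close> well defined. The resulting
  operator T is the two-sided inverse of the normalised derivative restricted to
  \<open>perp x\<close>.\<close>

lemma mu_operator:
  fixes f :: "('n::finite, 'm::finite) system"
  assumes dim: "CARD('m) = CARD('n) + 1" and x: "x \<noteq> 0" and rank: "rank_restr d f x = CARD('n)"
  obtains T where "bounded_linear T" "mu d f x = bw_norm d f * onorm T"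
    "\<forall>w. T w \<in> perp x" "\<forall>w. normalized_deriv d f x (T w) = w"
    "\<forall>v\<in>perp x. T (normalized_deriv d f x v) = v"
proof -
  let ?L = "\<lambda>v. Dsys d f x *v v"
  define S :: "complex^'n \<Rightarrow> complex^'n" where
    "S w = (\<chi> i. complex_of_real (sqrt (real (d i)) * norm x ^ (d i - 1)) * w $ i)" for w
  obtain h where h: "Vector_Spaces.linear (*s) (*s) h" "\<forall>w. h w \<in> perp x" "\<forall>w. ?L (h w) = w"
    using rank_restr_full_right_inverse[OF rank] by blast
  interpret h: Vector_Spaces.linear "(*s)" "(*s)" h by (rule h(1))
  have uniq: "v = v'" if "v \<in> perp x" "v' \<in> perp x" "?L v = ?L v'" for v v'
  proof -
    have "v - v' \<in> perp x" "?L (v - v') = 0"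
      using that by (simp_all add: perp_def hinner_simps matrix_vector_mult_diff_distrib)
    then show ?thesis
      using rank rank_restr_full_iff[OF dim x] by fastforce
  qed
  define T where "T w = h (S w)" for w
  have T_perp: "T w \<in> perp x" and LT: "?L (T w) = S w" for w
    using h by (simp_all add: T_def)
  have "(THE v. v \<in> perp x \<and> ?L v = S w) = T w" for w
    by (rule the_equality) (use T_perp LT uniq in auto)
  then have "mu d f x = bw_norm d f * onorm T"
    unfolding mu_def S_def by simp
  moreover have "bounded_linear T"
  proof -
    \<comment> \<open>The operator norm is taken over the reals while h is complex linear; a real
      scalar acts as the corresponding complex one.\<close>
    have scaleR: "r *\<^sub>R z = complex_of_real r *s z" for r and z :: "complex^'a::finite"
      unfolding vec_eq_iff vector_scaleR_component vector_smult_component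
      by (simp add: scaleR_conv_of_real)
    have "linear T"
    proof (rule linearI)
      fix a b r
      have "S (a + b) = S a + S b" "S (complex_of_real r *s a) = complex_of_real r *s S a"
        by (simp_all add: S_def vec_eq_iff algebra_simps)
      then show "T (a + b) = T a + T b" "T (r *\<^sub>R a) = r *\<^sub>R T a"
        by (simp_all add: T_def h.add h.scale scaleR)
    qed
    then show ?thesis
      by (simp add: linear_conv_bounded_linear)
  qed
  moreover have s: "complex_of_real (sqrt (real (d i)) * norm x ^ (d i - 1)) \<noteq> 0" for i
    using x rank_restr_full_degree_pos[OF rank, of i] by simp
  have "normalized_deriv d f x (T w) = w" for w
    unfolding normalized_deriv_def LT using s by (simp add: S_def vec_eq_iff)
  moreover have "T (normalized_deriv d f x v) = v" if v: "v \<in> perp x" for v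
  proof (rule uniq[OF T_perp v])
    show "?L (T (normalized_deriv d f x v)) = ?L v"
      unfolding LT S_def normalized_deriv_def using s by (simp add: vec_eq_iff)
  qed
  ultimately show thesis
    using that T_perp by blast
qed

text \<open>Bounds v = T(\<open>normalized_deriv d f x v\<close>) by the operator norm of T.
  Together with \<open>mu_least\<close> this characterises \<open>mu\<close> without mentioning an
  inverse.\<close>

lemma norm_le_mu:
  fixes f :: "('n::finite, 'm::finite) system"
  assumes "CARD('m) = CARD('n) + 1" "x \<noteq> 0" "rank_restr d f x = CARD('n)" and v: "v \<in> perp x"
  shows "bw_norm d f * norm v \<le> mu d f x * norm (normalized_deriv d f x v)"
proof -
  obtain T where T: "bounded_linear T" "mu d f x = bw_norm d f * onorm T"
    "\<forall>w. T w \<in> perp x" "\<forall>w. normalized_deriv d f x (T w) = w"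
    "\<forall>v\<in>perp x. T (normalized_deriv d f x v) = v"
    by (rule mu_operator[OF assms(1-3)])
  have "norm v \<le> onorm T * norm (normalized_deriv d f x v)"
    using onorm[OF T(1), of "normalized_deriv d f x v"] T(5) v by simp
  then show ?thesis
    unfolding T(2) mult.assoc by (intro mult_left_mono bw_norm_nonneg)
qed

lemma mu_nonneg:
  fixes f :: "('n::finite, 'm::finite) system"
  assumes "CARD('m) = CARD('n) + 1" "x \<noteq> 0" "rank_restr d f x = CARD('n)"
  shows "mu d f x \<ge> 0"
  by (rule mu_operator[OF assms]) (simp add: bw_norm_nonneg onorm_pos_le)

text \<open>Applying the hypothesis to T w, whose normalised derivative is w, bounds the operator
  norm of T.\<close>

lemma mu_least:
  fixes f :: "('n::finite, 'm::finite) system"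
  assumes "CARD('m) = CARD('n) + 1" "x \<noteq> 0" "rank_restr d f x = CARD('n)"
    and K: "K \<ge> 0" and f: "bw_norm d f > 0"
    and le: "\<And>v. v \<in> perp x \<Longrightarrow> bw_norm d f * norm v \<le> K * norm (normalized_deriv d f x v)"
  shows "mu d f x \<le> K"
proof -
  obtain T where T: "bounded_linear T" "mu d f x = bw_norm d f * onorm T"
    "\<forall>w. T w \<in> perp x" "\<forall>w. normalized_deriv d f x (T w) = w"
    "\<forall>v\<in>perp x. T (normalized_deriv d f x v) = v"
    by (rule mu_operator[OF assms(1-3)])
  have "onorm T \<le> K / bw_norm d f"
  proof (rule onorm_bound)
    fix w
    show "norm (T w) \<le> K / bw_norm d f * norm w"
      using le[OF T(3)[rule_format, of w]] f by (simp add: T(4) field_simps)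
  qed (use K f in simp)
  then show ?thesis
    using f by (simp add: T(2) field_simps)
qed

section \<open>Comparison of the two condition numbers\<close>

lemma dR_commute: "dR x y = dR y x"
proof -
  have "cmod (hinner x y) = cmod (hinner y x)"
    by (metis cnj_hinner complex_mod_cnj)
  then show ?thesis
    by (simp add: dR_def mult.commute)
qed

lemma dR_nonneg:
  assumes "x \<noteq> 0" "y \<noteq> 0"
  shows "dR x y \<ge> 0"
proof -
  have "0 \<le> cmod (hinner x y) / (norm x * norm y)" "cmod (hinner x y) / (norm x * norm y) \<le> 1"
    using assms hinner_Cauchy_Schwarz[of x y] by simp_all
  then show ?thesis
    unfolding dR_def by (intro arccos_lbound) linarith+
qed

lemma bw_norm_normalized:
  assumes "bw_norm d f > 0"
  shows "bw_norm d (\<lambda>i \<alpha>. f i \<alpha> / of_real (bw_norm d f)) = 1"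
proof -
  have "(bw_norm d (\<lambda>i \<alpha>. f i \<alpha> / of_real (bw_norm d f)))\<^sup>2 = (bw_norm d f)\<^sup>2 / (bw_norm d f)\<^sup>2"
    unfolding bw_norm_sq[of d "\<lambda>i \<alpha>. f i \<alpha> / of_real (bw_norm d f)"]
    by (simp add: norm_divide power_divide bw_norm_sq[symmetric] bw_norm_nonneg flip: sum_divide_distrib)
  then have "(bw_norm d (\<lambda>i \<alpha>. f i \<alpha> / of_real (bw_norm d f)))\<^sup>2 = 1\<^sup>2"
    using assms by simp
  then show ?thesis
    by (rule power2_eq_imp_eq) (simp_all add: bw_norm_nonneg)
qed

text \<open>The previous comparison applied to both systems divided by their norms; the factor
  \<open>bw_norm d f\<close> then becomes 1.\<close>

lemma exists_transported_vector_normalized: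
  fixes f g :: "('n::finite, 'm::finite) system"
  assumes d: "\<And>i. d i > 0" and D: "\<And>i. d i \<le> D"
    and x: "x \<noteq> 0" and y: "y \<noteq> 0"
    and f: "bw_norm d f > 0" and g: "bw_norm d g > 0" and v: "v \<in> perp x"
  obtains w where "w \<in> perp y" "norm w = norm v"
    "\<bar>norm (normalized_deriv d f x v) / bw_norm d f - norm (normalized_deriv d g y w) / bw_norm d g\<bar>
       \<le> (sys_normalized_diff d f g + sqrt (3 * real D - 2) * dR x y) * norm v"
proof -
  obtain w where "w \<in> perp y" "norm w = norm v"
    "\<bar>norm (normalized_deriv d (\<lambda>i \<alpha>. f i \<alpha> / of_real (bw_norm d f)) x v)
        - norm (normalized_deriv d (\<lambda>i \<alpha>. g i \<alpha> / of_real (bw_norm d g)) y w)\<bar>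
       \<le> (bw_norm d (\<lambda>i \<alpha>. f i \<alpha> / of_real (bw_norm d f) - g i \<alpha> / of_real (bw_norm d g))
          + sqrt (3 * real D - 2) * bw_norm d (\<lambda>i \<alpha>. f i \<alpha> / of_real (bw_norm d f)) * dR x y) * norm v"
    by (rule exists_transported_vector[OF d D x y v])
  then show thesis
    using that[of w] f g
    by (simp add: norm_normalized_deriv_divide bw_norm_normalized sys_normalized_diff_def)
qed

theorem theorem2:
  fixes d :: "'n::finite \<Rightarrow> nat"
    and f g :: "('n, 'm::finite) system"
    and x y :: "complex^'m"
  assumes n_ge: "CARD('n) \<ge> 2"
    and dim: "CARD('m) = CARD('n) + 1"
    and D_ge: "Max (range d) \<ge> 2"
    and f_nz: "sys_nonzero d f" and g_nz: "sys_nonzero d g"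
    and x_nz: "x \<noteq> 0" and y_nz: "y \<noteq> 0"
    and rank_f: "rank_restr d f x = CARD('n)"
    and u_le: "real (Max (range d)) powr (3/2) / 2 * mu d f x * dR x y \<le> 1/20"
    and v_le: "sqrt (real (Max (range d))) * mu d f x * sys_normalized_diff d f g \<le> 1/20"
  shows "rank_restr d g y = CARD('n) \<and>
    (let D = real (Max (range d));
         u = D powr (3/2) / 2 * mu d f x * dR x y;
         v = sqrt D * mu d f x * sys_normalized_diff d f g
     in (1 - 3.805 * u - v) * mu d g y \<le> mu d f x \<and>
        mu d f x \<le> (1 + 3.504 * u + v) * mu d g y)"
proof -
  define D where "D = Max (range d)"
  define u where "u = real D powr (3/2) / 2 * mu d f x * dR x y"
  define v where "v = sqrt (real D) * mu d f x * sys_normalized_diff d f g"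
  \<comment> \<open>Bound on the change of the normalised derivative per unit length, for systems
    scaled to norm 1.\<close>
  define e where "e = sys_normalized_diff d f g + sqrt (3 * real D - 2) * dR x y"
  have d: "\<And>i. d i > 0"
    by (rule rank_restr_full_degree_pos[OF rank_f])
  have D: "\<And>i. d i \<le> D"
    by (simp add: D_def)
  have fp: "bw_norm d f > 0" and gp: "bw_norm d g > 0"
    using f_nz g_nz by (auto intro: bw_norm_pos)
  have mu_f: "mu d f x \<ge> 0"
    by (rule mu_nonneg[OF dim x_nz rank_f])
  have diff_nonneg: "sys_normalized_diff d f g \<ge> 0"
    by (simp add: sys_normalized_diff_def bw_norm_nonneg)
  have \<theta>_nonneg: "dR x y \<ge> 0"
    by (rule dR_nonneg[OF x_nz y_nz])
  have D2: "real D \<ge> 2"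
    using D_ge by (simp add: D_def)
  have u0: "u \<ge> 0"
    using mu_f \<theta>_nonneg by (simp add: u_def)
  have e_le: "mu d f x * e \<le> 3.504 * u + v"
  proof -
    \<comment> \<open>The constant 1.752 is half of 3.504, because u carries a factor 1/2. Its
      square exceeds 3, so 3D - 2 \<le> 3D \<le> 1.752^2 D^3.\<close>
    have "sqrt (3 * real D - 2) \<le> 1.752 * real D powr (3/2)"
    proof (rule power2_le_imp_le)
      have "real D powr (3/2) = real D * sqrt (real D)"
        using D2 powr_add[of "real D" 1 "1/2"] by (simp add: powr_half_sqrt)
      then have "(1.752 * real D powr (3/2))\<^sup>2 = 1.752\<^sup>2 * (real D)\<^sup>2 * real D"
        by (simp only: power_mult_distrib real_sqrt_pow2[OF of_nat_0_le_iff] mult.assoc)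
      moreover have "3 * real D \<le> 1.752\<^sup>2 * (real D)\<^sup>2 * real D"
      proof (rule mult_right_mono)
        have "1 \<le> (real D)\<^sup>2" using D2 by simp
        then show "3 \<le> 1.752\<^sup>2 * (real D)\<^sup>2" by (simp add: power2_eq_square)
      qed simp
      moreover have "(sqrt (3 * real D - 2))\<^sup>2 = 3 * real D - 2"
        using D2 by simp
      ultimately show "(sqrt (3 * real D - 2))\<^sup>2 \<le> (1.752 * real D powr (3/2))\<^sup>2"
        by linarith
    qed simp
    then have "mu d f x * (sqrt (3 * real D - 2) * dR x y) \<le> mu d f x * (1.752 * real D powr (3/2) * dR x y)"
      using mu_f \<theta>_nonneg by (intro mult_left_mono mult_right_mono) auto
    moreover have "1 * (mu d f x * sys_normalized_diff d f g) \<le> sqrt (real D) * (mu d f x * sys_normalized_diff d f g)"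
      using D2 mu_f diff_nonneg by (intro mult_right_mono) auto
    ultimately show ?thesis
      by (simp add: e_def u_def v_def distrib_left mult_ac)
  qed
  \<comment> \<open>The bounds 1/20 on u and v give at most 4.504/20.\<close>
  then have e_lt: "mu d f x * e < 1"
    using u_le v_le by (simp add: u_def v_def D_def)
  \<comment> \<open>Transports w from y back to x, so only the full rank at (f, x) enters; the
    estimate is available before the rank at (g, y) is known.\<close>
  have lower: "(1 - mu d f x * e) * norm w \<le> mu d f x * (norm (normalized_deriv d g y w) / bw_norm d g)"
    if w: "w \<in> perp y" for w
  proof -
    obtain z where z: "z \<in> perp x" "norm z = norm w"
      "\<bar>norm (normalized_deriv d g y w) / bw_norm d g - norm (normalized_deriv d f x z) / bw_norm d f\<bar>
         \<le> (sys_normalized_diff d g f + sqrt (3 * real D - 2) * dR y x) * norm w"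
      by (rule exists_transported_vector_normalized[OF d D y_nz x_nz gp fp w])
    have "sys_normalized_diff d g f + sqrt (3 * real D - 2) * dR y x = e"
      unfolding e_def sys_normalized_diff_def 
      by (subst bw_norm_diff_commute) (simp add: dR_commute[of y x])
    then have le: "norm (normalized_deriv d f x z) / bw_norm d f
        \<le> norm (normalized_deriv d g y w) / bw_norm d g + e * norm w"
      using z(3) by simp
    have "norm w \<le> mu d f x * (norm (normalized_deriv d f x z) / bw_norm d f)"
      using norm_le_mu[OF dim x_nz rank_f z(1)] fp z(2) by (simp add: field_simps)
    also have "\<dots> \<le> mu d f x * (norm (normalized_deriv d g y w) / bw_norm d g + e * norm w)"
      using le mu_f by (rule mult_left_mono)
    finally show ?thesis
      by (simp add: algebra_simps)
  qed
  \<comment> \<open>By \<open>lower\<close>, the derivative of g at y has no nonzero kernel vector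
    in \<open>perp y\<close>.\<close>
  have rank_g: "rank_restr d g y = CARD('n)"
    unfolding rank_restr_full_iff[OF dim y_nz]
  proof (intro ballI impI)
    fix w assume w: "w \<in> perp y" "Dsys d g y *v w = 0"
    then have "normalized_deriv d g y w = 0"
      by (simp add: normalized_deriv_def vec_eq_iff)
    then have "(1 - mu d f x * e) * norm w \<le> 0"
      using lower[OF w(1)] by simp
    then show "w = 0"
      using e_lt by (simp add: mult_le_0_iff)
  qed
  have mu_g: "mu d g y \<ge> 0"
    by (rule mu_nonneg[OF dim y_nz rank_g])
  have "mu d g y \<le> mu d f x / (1 - mu d f x * e)"
  proof (rule mu_least[OF dim y_nz rank_g _ gp])
    show "bw_norm d g * norm w \<le> mu d f x / (1 - mu d f x * e) * norm (normalized_deriv d g y w)"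
      if "w \<in> perp y" for w
      using lower[OF that] gp e_lt by (simp add: field_simps)
  qed (use mu_f e_lt in simp)
  then have "(1 - mu d f x * e) * mu d g y \<le> mu d f x"
    using e_lt by (simp add: field_simps)
  \<comment> \<open>Here 3.504 \<le> 3.805 and u \<ge> 0 are used.\<close>
  moreover have "(1 - 3.805 * u - v) * mu d g y \<le> (1 - mu d f x * e) * mu d g y"
    using e_le u0 mu_g by (intro mult_right_mono) auto
  ultimately have first: "(1 - 3.805 * u - v) * mu d g y \<le> mu d f x"
    by linarith
  \<comment> \<open>Exchanging the roles of the two pairs gives (1 - \<open>mu d g y * e\<close>)
    \<open>mu d f x\<close> \<le> \<open>mu d g y\<close>, which rearranges to a bound with
    \<open>mu d f x * e\<close>, the quantity already controlled by u and v.\<close>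
  have "mu d f x \<le> (1 + mu d f x * e) * mu d g y"
  proof (cases "mu d g y * e < 1")
    \<comment> \<open>Here \<open>mu d g y * e\<close> is at least 1, so the product term on the
      right alone dominates \<open>mu d f x\<close>.\<close>
    case False
    then have "mu d f x * 1 \<le> mu d f x * (mu d g y * e)"
      using mu_f by (intro mult_left_mono) auto
    then show ?thesis
      using mu_g by (simp add: algebra_simps)
  next
    case True
    have "mu d f x \<le> mu d g y / (1 - mu d g y * e)"
    proof (rule mu_least[OF dim x_nz rank_f _ fp])
      fix z assume z: "z \<in> perp x"
      obtain w where w: "w \<in> perp y" "norm w = norm z"
        "\<bar>norm (normalized_deriv d f x z) / bw_norm d f - norm (normalized_deriv d g y w) / bw_norm d g\<bar>
           \<le> (sys_normalized_diff d f g + sqrt (3 * real D - 2) * dR x y) * norm z"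
        by (rule exists_transported_vector_normalized[OF d D x_nz y_nz fp gp z])
      then have le: "norm (normalized_deriv d g y w) / bw_norm d g
          \<le> norm (normalized_deriv d f x z) / bw_norm d f + e * norm z"
        by (simp add: e_def)
      have "norm z \<le> mu d g y * (norm (normalized_deriv d g y w) / bw_norm d g)"
        using norm_le_mu[OF dim y_nz rank_g w(1)] gp w(2) by (simp add: field_simps)
      also have "\<dots> \<le> mu d g y * (norm (normalized_deriv d f x z) / bw_norm d f + e * norm z)"
        using le mu_g by (rule mult_left_mono)
      finally have "(1 - mu d g y * e) * norm z \<le> mu d g y * (norm (normalized_deriv d f x z) / bw_norm d f)"
        by (simp add: algebra_simps)
      then show "bw_norm d f * norm z \<le> mu d g y / (1 - mu d g y * e) * norm (normalized_deriv d f x z)"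
        using fp True by (simp add: field_simps)
    qed (use mu_g True in simp)
    then show ?thesis
      using True by (simp add: field_simps)
  qed
  moreover have "(1 + mu d f x * e) * mu d g y \<le> (1 + 3.504 * u + v) * mu d g y"
    using e_le mu_g by (intro mult_right_mono) auto
  ultimately have second: "mu d f x \<le> (1 + 3.504 * u + v) * mu d g y"
    by linarith
  show ?thesis
    using rank_g first second unfolding Let_def u_def v_def D_def by blast
qed

end
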